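(* For a semimodular lattice $L$, the following three conditions are equivalent. (i) $L$ is join-distributive. (ii) $L$ is of finite length, and for every trajectory $T$ of $L$ and every maximal chain $C$ of $L$, $|\mathrm{PrInt}(C)\cap T|=1$. (iii) $L$ is of finite length, and no two distinct comparable prime intervals of $L$ belong to the same trajectory.
   Context: $a\prec b$ means that $b$ covers $a$. A lattice is semimodular if $a\prec b$ implies that $a\vee c=b\vee c$ or $a\vee c\prec b\vee c$, for all elements $a,b,c$. A lattice is of finite length if there is a finite upper bound on the lengths of its chains. Join-distributive: for a finite lattice $L$ with top element $1$ and $x\in L\setminus\{1\}$, let $x^{\ast}$ denote the join of all upper covers of $x$. A lattice $L$ is join-distributive if it is finite and, for every $x\in L\setminus\{1\}$, the interval $[x,x^{\ast}]$ is a distributive lattice. (In particular, finiteness is part of the definition of join-distributivity.) Prime intervals: for a lattice $L$ of finite length, $\mathrm{PrInt}(L)=\{[a,b]: a,b\in L,\ a\prec b\}$ is the set of prime intervals of $L$. For a maximal chain $C$ of $L$, $\mathrm{PrInt}(C)$ is the set of prime intervals of $C$, that is, those $[a,b]$ with $a,b\in C$ and $a\prec b$; since $C$ is a maximal chain, these are identified with the prime intervals $[a,b]$ of $L$ with $a,b\in C$. Trajectories: two prime intervals $[a,b],[c,d]\in\mathrm{PrInt}(L)$ are consecutive if $\{a,b,c,d\}$ is a covering square, that is, a 4-element cover-preserving boolean sublattice of $L$ (cover-preserving means that coverings in the sublattice are also coverings in $L$). The reflexive transitive closure of the consecutiveness relation is an equivalence relation on $\mathrm{PrInt}(L)$; its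 blocks are called the trajectories of $L$. Comparable: distinct prime intervals $[a,b],[c,d]\in\mathrm{PrInt}(L)$ are comparable if $b\le c$ or $d\le a$. *)

theory Defs
  imports Main
begin

text \<open>
  A lattice is modelled by a type of class \<open>lattice\<close>; properties of the whole lattice
  are predicates on \<open>TYPE('a)\<close>.  Subsets of the type carry the induced order.
\<close>

text \<open>Covering in the poset induced on \<open>S\<close>.\<close>

definition covered_in :: "'a::order set \<Rightarrow> 'a \<Rightarrow> 'a \<Rightarrow> bool" where
  "covered_in S a b \<longleftrightarrow> a \<in> S \<and> b \<in> S \<and> a < b \<and> \<not> (\<exists>z\<in>S. a < z \<and> z < b)"

abbreviation covered :: "'a::order \<Rightarrow> 'a \<Rightarrow> bool" where
  "covered \<equiv> covered_in UNIV"

definition semimodular :: "'a::lattice itself \<Rightarrow> bool" where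
  "semimodular TYPE('a) \<longleftrightarrow>
     (\<forall>a b c :: 'a. covered a b \<longrightarrow> sup a c = sup b c \<or> covered (sup a c) (sup b c))"

text \<open>
  A chain of length \<open>n\<close> has \<open>n + 1\<close> elements.  Finiteness is required explicitly because
  \<open>card\<close> is \<open>0\<close> on infinite sets.
\<close>

definition finite_length :: "'a::lattice itself \<Rightarrow> bool" where
  "finite_length TYPE('a) \<longleftrightarrow>
     (\<exists>n. \<forall>C :: 'a set. pred_on.chain UNIV (<) C \<longrightarrow> finite C \<and> card C \<le> n + 1)"

abbreviation maximal_chain :: "'a::order set \<Rightarrow> bool" where
  "maximal_chain \<equiv> pred_on.maxchain UNIV (<)"

definition sublattice :: "'a::lattice set \<Rightarrow> bool" where
  "sublattice S \<longleftrightarrow> S \<noteq> {} \<and> (\<forall>x\<in>S. \<forall>y\<in>S. inf x y \<in> S \<and> sup x y \<in> S)"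

definition distributive_sublattice :: "'a::lattice set \<Rightarrow> bool" where
  "distributive_sublattice S \<longleftrightarrow> sublattice S \<and>
     (\<forall>x\<in>S. \<forall>y\<in>S. \<forall>z\<in>S. sup x (inf y z) = inf (sup x y) (sup x z))"

text \<open>
  The bounds \<open>u\<close> and \<open>v\<close> are those of \<open>S\<close>, not necessarily those of the ambient lattice.
\<close>

definition boolean_sublattice :: "'a::lattice set \<Rightarrow> bool" where
  "boolean_sublattice S \<longleftrightarrow> distributive_sublattice S \<and>
     (\<exists>u\<in>S. \<exists>v\<in>S. (\<forall>x\<in>S. u \<le> x \<and> x \<le> v) \<and>
        (\<forall>x\<in>S. \<exists>y\<in>S. inf x y = u \<and> sup x y = v))"

definition cover_preserving :: "'a::lattice set \<Rightarrow> bool" where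
  "cover_preserving S \<longleftrightarrow> (\<forall>x y. covered_in S x y \<longrightarrow> covered x y)"

definition covering_square :: "'a::lattice set \<Rightarrow> bool" where
  "covering_square S \<longleftrightarrow> card S = 4 \<and> boolean_sublattice S \<and> cover_preserving S"

text \<open>
  The join of all upper covers of \<open>x\<close>.  \<open>Sup_fin\<close> is meaningful only on finite nonempty
  sets; it is used only for non-top elements of finite lattices.
\<close>

definition join_upper_covers :: "'a::lattice \<Rightarrow> 'a" where
  "join_upper_covers x = Sup_fin {y. covered x y}"

text \<open>Class \<open>lattice\<close> has no constant for the top, so \<open>x\<close> being below the top is
  expressed by \<open>x\<close> not being a greatest element.\<close>

definition join_distributive :: "'a::lattice itself \<Rightarrow> bool" where
  "join_distributive TYPE('a) \<longleftrightarrow> finite (UNIV :: 'a set) \<and>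
     (\<forall>x :: 'a. \<not> (\<forall>y. y \<le> x) \<longrightarrow> distributive_sublattice {x..join_upper_covers x})"

text \<open>The prime interval \<open>[a, b]\<close> is represented by the pair \<open>(a, b)\<close> of its endpoints.\<close>

definition PrInt :: "'a::order set \<Rightarrow> ('a \<times> 'a) set" where
  "PrInt S = {(a, b). covered_in S a b}"

definition consecutive :: "(('a::lattice \<times> 'a) \<times> ('a \<times> 'a)) set" where
  "consecutive = {((a, b), (c, d)). (a, b) \<in> PrInt UNIV \<and> (c, d) \<in> PrInt UNIV \<and>
     covering_square {a, b, c, d}}"

text \<open>
  The closure below is reflexive on all pairs, but \<open>consecutive\<close> only relates prime
  intervals, so the class of a prime interval consists of prime intervals.
\<close>

definition trajectories :: "('a::lattice \<times> 'a) set set" where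
  "trajectories = PrInt UNIV // consecutive\<^sup>*"

definition comparable :: "'a::lattice \<times> 'a \<Rightarrow> 'a \<times> 'a \<Rightarrow> bool" where
  "comparable p q \<longleftrightarrow> p \<noteq> q \<and> (snd p \<le> fst q \<or> snd q \<le> fst p)"

end

theory Submission
  imports Defs
begin

text \<open>
  Everything rests on one local condition: an upper cover of \<open>a\<close> is never below the join of
  two other upper covers of \<open>a\<close>.  For semimodular lattices of finite length it propagates upwards:
  if \<open>b\<close> covers \<open>a\<close>, then the elements above \<open>a\<close> that are not above \<open>b\<close> are closed under joins
  and so have a greatest element.  This element labels the prime interval \<open>[a, b]\<close>, it is constant
  on trajectories, and comparable prime intervals have different labels; this gives (iii).

  In any semimodular lattice of finite length a trajectory meets every maximal chain, since a
  prime interval can be moved upwards along the chain until it is about to collapse, where it is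
  perspective to a prime interval of the chain.  Hence (ii) and (iii) are equivalent.

  Under (iii), three upper covers violating the local condition would generate a diamond, whose
  prime intervals all lie in one trajectory, so the local condition holds.  The upper covers of an
  element lie in different trajectories, so there are finitely many of them and \<open>L\<close> is finite.
  Finally, sending \<open>y\<close> to the set of upper covers of \<open>x\<close> below \<open>y\<close> embeds the interval from
  \<open>x\<close> to the join of its upper covers into a powerset lattice.
\<close>

section \<open>Lattices of finite length\<close>

lemma coveredD: "covered a b \<Longrightarrow> a < b"
  by (simp add: covered_in_def)

lemma covered_between: "covered a b \<Longrightarrow> a \<le> z \<Longrightarrow> z \<le> b \<Longrightarrow> z = a \<or> z = b"
  by (auto simp: covered_in_def order.order_iff_strict)

lemma covered_antichain: "covered a b \<Longrightarrow> covered a c \<Longrightarrow> b \<le> c \<Longrightarrow> b = c"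
  using covered_between[of a c b] coveredD[of a b] by (auto dest: less_imp_le)

lemma covered_inf_eq:
  fixes a b m :: "'a::lattice"
  assumes "covered a b" "a \<le> m" "\<not> b \<le> m"
  shows "inf b m = a"
  using covered_between[OF assms(1), of "inf b m"] coveredD[OF assms(1)] assms(2,3)
  by (metis inf.cobounded1 inf.cobounded2 le_inf_iff less_imp_le)

text \<open>Since \<open>sup a c = c\<close>, the alternative \<open>sup a c = sup b c\<close> would
  give \<open>b \<le> c\<close>; only the covering remains.\<close>

lemma semimodularD:
  fixes a b c :: "'a::lattice"
  assumes "semimodular TYPE('a)" "covered a b" "a \<le> c" "\<not> b \<le> c"
  shows "covered c (sup b c)"
proof -
  have "sup a c = c" using assms(3) by (rule sup_absorb2)
  moreover have "sup b c \<noteq> c" using assms(4) by (metis sup.cobounded1)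
  ultimately show ?thesis using assms(1,2) unfolding semimodular_def by metis
qed

lemma finite_length_chain:
  assumes "finite_length TYPE('a::lattice)" "pred_on.chain UNIV (<) (C :: 'a set)"
  shows "finite C"
  using assms by (auto simp: finite_length_def)

lemma finite_length_of_finite:
  assumes "finite (UNIV :: 'a::lattice set)"
  shows "finite_length TYPE('a)"
  unfolding finite_length_def
proof (intro exI allI impI conjI)
  fix C :: "'a set"
  show "finite C" using assms by (rule rev_finite_subset) simp
  show "card C \<le> card (UNIV :: 'a set) + 1"
    using card_mono[OF assms, of C] by simp
qed

lemma chain_iff:
  "pred_on.chain UNIV (<) (C :: 'a::order set) \<longleftrightarrow> (\<forall>x\<in>C. \<forall>y\<in>C. x \<le> y \<or> y \<le> x)"
  by (auto simp: pred_on.chain_def order.order_iff_strict)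

text \<open>The range would be an infinite chain. Pairwise comparability in place of monotonicity
  lets the lemma serve ascending and descending sequences alike.\<close>

lemma finite_length_no_monotone_seq:
  fixes f :: "nat \<Rightarrow> 'a::lattice"
  assumes "finite_length TYPE('a)" "\<And>i j. f i \<le> f j \<or> f j \<le> f i" "inj f"
  shows False
proof -
  have "pred_on.chain UNIV (<) (range f)" using assms(2) by (auto simp: chain_iff)
  then have "finite (range f)" by (rule finite_length_chain[OF assms(1)])
  then show False using finite_imageD[OF _ assms(3)] by simp
qed

lemma finite_length_wf_greater:
  assumes "finite_length TYPE('a::lattice)"
  shows "wf {(y, x :: 'a). x < y}"
  unfolding wf_iff_no_infinite_down_chain
proof
  assume "\<exists>f. \<forall>i. (f (Suc i), f i) \<in> {(y, x :: 'a). x < y}"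
  then obtain f :: "nat \<Rightarrow> 'a" where "\<And>i. f i < f (Suc i)" by auto
  then have sm: "strict_mono f" by (simp add: strict_mono_Suc_iff)
  show False
  proof (rule finite_length_no_monotone_seq[OF assms])
    show "f i \<le> f j \<or> f j \<le> f i" for i j
      using strict_mono_less_eq[OF sm] nat_le_linear by blast
    show "inj f" using sm by (rule strict_mono_imp_inj_on)
  qed
qed

lemma finite_length_wf_less:
  assumes "finite_length TYPE('a::lattice)"
  shows "wf {(x, y :: 'a). x < y}"
  unfolding wf_iff_no_infinite_down_chain
proof
  assume "\<exists>f. \<forall>i. (f (Suc i), f i) \<in> {(x, y :: 'a). x < y}"
  then obtain f :: "nat \<Rightarrow> 'a" where dec: "\<And>i. f (Suc i) < f i" by auto
  have lt: "f j < f i" if "i < j" for i j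
    using that by (induction rule: strict_inc_induct) (auto intro: dec less_trans)
  show False
  proof (rule finite_length_no_monotone_seq[OF assms])
    show "f i \<le> f j \<or> f j \<le> f i" for i j
      using lt[of i j] lt[of j i] by (cases i j rule: linorder_cases) auto
    show "inj f"
      by (rule injI, rule ccontr) (metis lt less_irrefl nat_neq_iff)
  qed
qed

lemma finite_length_minimal:
  assumes "finite_length TYPE('a::lattice)" "x \<in> (S :: 'a set)"
  shows "\<exists>z\<in>S. \<forall>y\<in>S. \<not> y < z"
  by (rule wfE_min[OF finite_length_wf_less[OF assms(1)] assms(2)]) blast

lemma finite_length_maximal:
  assumes "finite_length TYPE('a::lattice)" "x \<in> (S :: 'a set)"
  shows "\<exists>z\<in>S. \<forall>y\<in>S. \<not> z < y"
  by (rule wfE_min[OF finite_length_wf_greater[OF assms(1)] assms(2)]) blast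

lemma finite_length_greater_induct:
  fixes x :: "'a::lattice"
  assumes "finite_length TYPE('a)"
    and "\<And>x. (\<And>y. x < y \<Longrightarrow> P y) \<Longrightarrow> P x"
  shows "P x"
  using finite_length_wf_greater[OF assms(1)]
  by (induction x rule: wf_induct_rule) (auto intro: assms(2))

lemma finite_length_cover_below:
  fixes a m :: "'a::lattice"
  assumes "finite_length TYPE('a)" "a < m"
  obtains c where "covered a c" "c \<le> m"
proof -
  have "m \<in> {z. a < z \<and> z \<le> m}" using assms(2) by simp
  from finite_length_minimal[OF assms(1) this]
  obtain c where c: "c \<in> {z. a < z \<and> z \<le> m}" "\<forall>y\<in>{z. a < z \<and> z \<le> m}. \<not> y < c" ..
  have "covered a c" using c unfolding covered_in_def
    by (metis (mono_tags, lifting) UNIV_I less_imp_le mem_Collect_eq order_trans)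
  then show ?thesis using c(1) that by simp
qed

lemma finite_length_bot:
  assumes "finite_length TYPE('a::lattice)"
  obtains z :: "'a::lattice" where "\<And>x. z \<le> x"
proof -
  \<comment> \<open>\<open>undefined\<close> only witnesses that the universe is nonempty. In a
    lattice a minimal \<open>z\<close> is least, because \<open>inf z x\<close> cannot lie strictly
    below it.\<close>
  obtain z :: 'a where z: "\<And>y. \<not> y < z"
    using finite_length_minimal[OF assms, of undefined UNIV] by auto
  have "z \<le> x" for x using z[of "inf z x"]
    by (metis order.order_iff_strict inf.cobounded1 inf.cobounded2)
  then show ?thesis by (rule that)
qed

lemma finite_length_top:
  assumes "finite_length TYPE('a::lattice)"
  obtains z :: "'a::lattice" where "\<And>x. x \<le> z"
proof -
  obtain z :: 'a where z: "\<And>y. \<not> z < y"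
    using finite_length_maximal[OF assms, of undefined UNIV] by auto
  have "x \<le> z" for x using z[of "sup z x"]
    by (metis order.order_iff_strict sup.cobounded1 sup.cobounded2)
  then show ?thesis by (rule that)
qed

section \<open>Maximal chains\<close>

text \<open>A chain of greatest cardinality among those containing \<open>X\<close> is maximal, and
  the bound on lengths makes such a chain exist.\<close>

lemma chain_extends_maximal:
  fixes X :: "'a::lattice set"
  assumes "finite_length TYPE('a)" "pred_on.chain UNIV (<) X"
  obtains C where "maximal_chain C" "X \<subseteq> C"
proof -
  let ?P = "\<lambda>C :: 'a set. pred_on.chain UNIV (<) C \<and> X \<subseteq> C"
  obtain n where n: "\<And>C :: 'a set. pred_on.chain UNIV (<) C \<Longrightarrow> finite C \<and> card C \<le> n + 1"
    using assms(1) unfolding finite_length_def by blast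
  have "\<exists>C. ?P C \<and> (\<forall>D. ?P D \<longrightarrow> card D \<le> card C)"
  proof (rule ex_has_greatest_nat)
    show "?P X" using assms(2) by simp
    \<comment> \<open>Chains have at most \<open>n + 1\<close> elements, and the bound has to be
      strict.\<close>
    show "\<forall>D. ?P D \<longrightarrow> card D < n + 2" using n by (simp add: less_Suc_eq_le)
  qed
  then obtain C where C: "?P C" "\<And>D. ?P D \<Longrightarrow> card D \<le> card C" by blast
  have "\<not> C \<subset> S" if S: "pred_on.chain UNIV (<) S" for S
  proof
    assume "C \<subset> S"
    then have "card C < card S" using n[OF S] psubset_card_mono by blast
    moreover have "card S \<le> card C" using C(2)[of S] C(1) S \<open>C \<subset> S\<close> by auto
    ultimately show False by simp
  qed
  then have "maximal_chain C" using C(1) unfolding pred_on.maxchain_def by blast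
  then show ?thesis using C(1) that by blast
qed

lemma maximal_chain_linear:
  "maximal_chain C \<Longrightarrow> x \<in> C \<Longrightarrow> y \<in> C \<Longrightarrow> x \<le> y \<or> y \<le> x"
  unfolding pred_on.maxchain_def chain_iff by blast

lemma maximal_chain_memI:
  fixes C :: "'a::lattice set"
  assumes C: "maximal_chain C" and "\<And>x. x \<in> C \<Longrightarrow> x \<le> z \<or> z \<le> x"
  shows "z \<in> C"
proof -
  have "pred_on.chain UNIV (<) (insert z C)"
    using assms(2) maximal_chain_linear[OF C] unfolding chain_iff by auto
  then have "\<not> C \<subset> insert z C" using C unfolding pred_on.maxchain_def by blast
  then show ?thesis by blast
qed

section \<open>Trajectories\<close>

lemma consecutive_sym: "(p, q) \<in> consecutive \<Longrightarrow> (q, p) \<in> consecutive"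
  by (cases p; cases q) (auto simp: consecutive_def insert_commute)

lemma sym_rtrancl_consecutive: "sym (consecutive\<^sup>*)"
  by (rule sym_rtrancl, rule symI, rule consecutive_sym)

text \<open>The least element of the square is the lower end of one interval, and the greatest is an
  upper end. They do not belong to the same interval, for then the square would be a chain, whose
  inner elements have no complements. Hence one interval is an upward transpose of the
  other.\<close>

lemma consecutive_cases:
  assumes "(p, q) \<in> consecutive"
  obtains (up) u x y v where "p = (u, x)" "q = (y, v)" "covered u x" "covered y v"
      "u \<le> y" "v = sup x y" "\<not> x \<le> y"
  | (down) u x y v where "p = (y, v)" "q = (u, x)" "covered u x" "covered y v"
      "u \<le> y" "v = sup x y" "\<not> x \<le> y"
proof -
  obtain a b c d where pq: "p = (a, b)" "q = (c, d)" by (cases p; cases q)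
  let ?S = "{a, b, c, d}"
  have cov: "covered a b" "covered c d" and card: "card ?S = 4" and "boolean_sublattice ?S"
    using assms by (auto simp: consecutive_def PrInt_def covering_square_def pq)
  then obtain u v where u: "u \<in> ?S" "\<forall>x\<in>?S. u \<le> x" and v: "v \<in> ?S" "\<forall>x\<in>?S. x \<le> v"
    and compl: "\<And>x. x \<in> ?S \<Longrightarrow> \<exists>y\<in>?S. inf x y = u \<and> sup x y = v"
    unfolding boolean_sublattice_def by blast
  have lt: "a < b" "c < d" using cov by (auto dest: coveredD)
  have neq: "a \<noteq> c" "a \<noteq> d" "b \<noteq> c" "b \<noteq> d"
    using card lt by (auto simp: card_insert_if split: if_splits)
  have uv: "u = a \<and> v = d \<or> u = c \<and> v = b"
  proof -
    have "u = a \<or> u = c" using u lt by auto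
    moreover have "v = b \<or> v = d" using v lt by auto
    moreover have False if "u = a" "v = b"
      using compl[of c] u v lt neq that
      by (auto simp: inf_absorb1 inf_absorb2 sup_absorb1 sup_absorb2)
    moreover have False if "u = c" "v = d"
      using compl[of a] u v lt neq that
      by (auto simp: inf_absorb1 inf_absorb2 sup_absorb1 sup_absorb2)
    ultimately show ?thesis by blast
  qed
  then show thesis
  proof
    assume h: "u = a \<and> v = d"
    \<comment> \<open>Only \<open>c\<close> can be the complement of \<open>b\<close>, which makes
      \<open>d\<close> the join of \<open>b\<close> and \<open>c\<close>.\<close>
    have "\<exists>y\<in>?S. inf b y = a \<and> sup b y = d" using compl[of b] h by simp
    then obtain y where y: "y \<in> ?S" "inf b y = a" "sup b y = d" by (elim bexE conjE)
    moreover have "y \<noteq> a" "y \<noteq> b" "y \<noteq> d"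
      using y lt neq u v h by (auto simp: inf_absorb1 sup_absorb1)
    ultimately have bc: "inf b c = a \<and> sup b c = d" by blast
    then have "\<not> b \<le> c" using lt by (auto simp: inf_absorb1)
    then show thesis using up[OF pq cov _ bc[THEN conjunct2, symmetric]] u h by simp
  next
    assume h: "u = c \<and> v = b"
    have "\<exists>y\<in>?S. inf d y = c \<and> sup d y = b" using compl[of d] h by simp
    then obtain y where y: "y \<in> ?S" "inf d y = c" "sup d y = b" by (elim bexE conjE)
    moreover have "y \<noteq> c" "y \<noteq> d" "y \<noteq> b"
      using y lt neq u v h by (auto simp: inf_absorb1 sup_absorb1)
    ultimately have bc: "inf d a = c \<and> sup d a = b" by blast
    then have "\<not> d \<le> a" using lt by (auto simp: inf_absorb1)
    then show thesis using down[OF pq cov(2,1) _ bc[THEN conjunct2, symmetric]] u h by simp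
  qed
qed

text \<open>By semimodularity \<open>sup b c\<close> covers both \<open>b\<close> and
  \<open>c\<close>, so two distinct upper covers of \<open>a\<close> span a covering square.\<close>

lemma consecutiveI:
  fixes a b c :: "'a::lattice"
  assumes sm: "semimodular TYPE('a)" and ab: "covered a b" and ac: "covered a c" and "b \<noteq> c"
  shows "((a, b), (c, sup b c)) \<in> consecutive"
proof -
  let ?v = "sup b c"
  have lt: "a < b" "a < c" using ab ac by (auto dest: coveredD)
  have n: "\<not> b \<le> c" "\<not> c \<le> b"
      using covered_antichain[OF ab ac] covered_antichain[OF ac ab] \<open>b \<noteq> c\<close> by auto
  have cv: "covered c ?v" using semimodularD[OF sm ab _ n(1)] lt by simp
  have bv: "covered b ?v" using semimodularD[OF sm ac _ n(2)] lt by (simp add: sup_commute)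
  have inf: "inf b c = a" "inf c b = a"
    using covered_inf_eq[OF ab _ n(1)] lt by (auto simp: inf_commute)
  have ltv: "b < ?v" "c < ?v" "a < ?v"
    using coveredD[OF cv] coveredD[OF bv] lt by auto
  have le: "a \<le> b" "a \<le> c" "a \<le> ?v" "sup c b = ?v"
    using lt ltv by (auto simp: sup_commute)
  note ops = le inf inf_absorb1 inf_absorb2 sup_absorb1 sup_absorb2
  let ?S = "{a, b, c, ?v}"
  have "distinct [a, b, c, ?v]" using lt ltv \<open>b \<noteq> c\<close> by (metis distinct_length_2_or_more distinct_singleton less_irrefl)
  then have "card ?S = 4" using distinct_card[of "[a, b, c, ?v]"] by simp
  moreover have "boolean_sublattice ?S"
    unfolding boolean_sublattice_def
  proof
    show "distributive_sublattice ?S"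
      unfolding distributive_sublattice_def sublattice_def by (simp add: ops)
    show "\<exists>u\<in>?S. \<exists>v\<in>?S. (\<forall>x\<in>?S. u \<le> x \<and> x \<le> v) \<and> (\<forall>x\<in>?S. \<exists>y\<in>?S. inf x y = u \<and> sup x y = v)"
      by (rule bexI[of _ a], rule bexI[of _ ?v]) (auto simp: ops)
  qed
  moreover have "cover_preserving ?S"
    unfolding cover_preserving_def
  proof (intro allI impI)
    fix x y assume h: "covered_in ?S x y"
    then have xy: "x \<in> ?S" "y \<in> ?S" "x < y" "\<not> (\<exists>z\<in>?S. x < z \<and> z < y)"
      by (auto simp: covered_in_def)
    \<comment> \<open>The pair \<open>(a, ?v)\<close> drops out because \<open>b\<close> lies
      strictly between.\<close>
    then have "(x, y) \<in> {(a, b), (a, c), (b, ?v), (c, ?v)}"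
      using lt ltv n by (auto dest: less_imp_le less_asym)
    then show "covered x y" using ab ac bv cv by auto
  qed
  ultimately show ?thesis
    using ab cv unfolding consecutive_def PrInt_def covering_square_def by blast
qed

section \<open>Moving prime intervals within a trajectory\<close>

text \<open>Upward induction on \<open>a\<close>: a cover \<open>c\<close> of \<open>a\<close> below
  \<open>e\<close> gives one covering square, and the claim for \<open>[c, sup b c]\<close>
  finishes, since joining with \<open>e\<close> absorbs \<open>c\<close>.\<close>

lemma up_perspective_trajectory:
  fixes a b e :: "'a::lattice"
  assumes fl: "finite_length TYPE('a)" and sm: "semimodular TYPE('a)"
    and "covered a b" "a \<le> e" "\<not> b \<le> e"
  shows "((a, b), (e, sup b e)) \<in> consecutive\<^sup>*"
  using assms(3-)
proof (induction a arbitrary: b rule: finite_length_greater_induct[OF fl])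
  case (1 a)
  have ab: "a < b" using 1 by (auto dest: coveredD)
  show ?case
  proof (cases "a = e")
    case True
    then show ?thesis using ab by (simp add: sup_absorb1)
  next
    case False
    then obtain c where c: "covered a c" "c \<le> e"
      using finite_length_cover_below[OF fl, of a e] 1(3) by (metis order.order_iff_strict)
    have "b \<noteq> c" "\<not> b \<le> c" using c 1(4) by auto
    have "((a, b), (c, sup b c)) \<in> consecutive" by (rule consecutiveI) fact+
    moreover have "((c, sup b c), (e, sup (sup b c) e)) \<in> consecutive\<^sup>*"
    proof (rule 1(1))
      show "a < c" using c by (auto dest: coveredD)
      then show "covered c (sup b c)" using semimodularD[OF sm 1(2) _ \<open>\<not> b \<le> c\<close>] by simp
    qed (use c 1 in auto)
    moreover have "sup (sup b c) e = sup b e" using c by (simp add: sup_assoc sup_absorb2)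
    ultimately show ?thesis by (metis converse_rtrancl_into_rtrancl)
  qed
qed

text \<open>Let \<open>c\<close> be the last element of the chain with \<open>b\<close> not below
  \<open>sup a c\<close>, and \<open>d\<close> its successor there. Both \<open>[a, b]\<close> and
  \<open>[c, d]\<close> transpose up to the same prime interval with lower end
  \<open>sup a c\<close>.\<close>

lemma maximal_chain_meets_trajectory:
  fixes a b :: "'a::lattice"
  assumes fl: "finite_length TYPE('a)" and sm: "semimodular TYPE('a)"
    and C: "maximal_chain C" and ab: "covered a b"
  obtains c d where "(c, d) \<in> PrInt C" "((a, b), (c, d)) \<in> consecutive\<^sup>*"
proof -
  obtain bot :: 'a where bot: "\<And>x. bot \<le> x" using finite_length_bot[OF fl] by blast
  obtain top :: 'a where top: "\<And>x. x \<le> top" using finite_length_top[OF fl] by blast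
  have mem: "bot \<in> C" "top \<in> C" by (rule maximal_chain_memI[OF C]; simp add: bot top)+
  let ?G = "{c \<in> C. \<not> b \<le> sup a c}"
  have "bot \<in> ?G" using mem coveredD[OF ab] bot[of a] by (simp add: sup_absorb1)
  from finite_length_maximal[OF fl this]
  obtain c where c: "c \<in> ?G" and cmax: "\<forall>y\<in>?G. \<not> c < y" ..
  have "sup a top = top" by (rule sup_absorb2) (rule top)
  then have "\<not> \<not> b \<le> sup a top" by (simp add: top)
  then have "c \<noteq> top" using c by blast
  then have "c < top" using top[of c] by simp
  then have "top \<in> {z \<in> C. c < z}" using mem by simp
  from finite_length_minimal[OF fl this]
  obtain d where "d \<in> {z \<in> C. c < z}" "\<forall>y\<in>{z \<in> C. c < z}. \<not> y < d" ..
  then have d: "d \<in> C" "c < d" and dmin: "\<And>y. y \<in> C \<Longrightarrow> c < y \<Longrightarrow> \<not> y < d" by simp_all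
  \<comment> \<open>An element strictly between \<open>c\<close> and its successor \<open>d\<close>
    would be comparable to the whole chain, so the successor is a cover in the lattice.\<close>
  have "z \<in> C" if "c < z" "z < d" for z
  proof (rule maximal_chain_memI[OF C])
    fix x assume "x \<in> C"
    then have "x \<le> c \<or> d \<le> x"
      using maximal_chain_linear[OF C \<open>x \<in> C\<close>, of c] maximal_chain_linear[OF C \<open>x \<in> C\<close>, of d]
        c d dmin[of x] by (auto simp: order.order_iff_strict)
    then show "x \<le> z \<or> z \<le> x" using that by (meson less_imp_le order_trans)
  qed
  then have cd: "covered c d" using d dmin unfolding covered_in_def by blast
  have PrC: "(c, d) \<in> PrInt C"
    using c d dmin by (auto simp: PrInt_def covered_in_def)
  let ?e = "sup a c"
  have be: "\<not> b \<le> ?e" using c by simp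
  have bd: "b \<le> sup a d" using cmax d by blast
  have de: "\<not> d \<le> ?e"
  proof
    assume "d \<le> ?e"
    then have "sup a d \<le> ?e" by simp
    then show False using bd be order_trans by blast
  qed
  have eb: "covered ?e (sup b ?e)" using semimodularD[OF sm ab _ be] by simp
  have ed: "covered ?e (sup d ?e)" using semimodularD[OF sm cd _ de] by simp
  \<comment> \<open>From \<open>b \<le> sup a d\<close> the two covers of \<open>?e\<close> are
    comparable, hence equal.\<close>
  have "sup a d \<le> sup d ?e" by (simp add: sup.coboundedI2)
  then have "sup b ?e \<le> sup d ?e" using order_trans[OF bd] by simp
  then have "sup b ?e = sup d ?e"
    using covered_between[OF ed, of "sup b ?e"] coveredD[OF eb] by auto
  moreover have "((a, b), (?e, sup b ?e)) \<in> consecutive\<^sup>*"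
    using up_perspective_trajectory[OF fl sm ab _ be] by simp
  moreover have "((c, d), (?e, sup d ?e)) \<in> consecutive\<^sup>*"
    using up_perspective_trajectory[OF fl sm cd _ de] by simp
  ultimately have "((a, b), (c, d)) \<in> consecutive\<^sup>*"
    using sym_rtrancl_consecutive by (metis rtrancl_trans symD)
  then show ?thesis using PrC that by blast
qed

lemma trajectories_sameD:
  assumes "T \<in> trajectories" "p \<in> T" "q \<in> T"
  shows "(p, q) \<in> consecutive\<^sup>*"
proof -
  obtain r where "(r, p) \<in> consecutive\<^sup>*" "(r, q) \<in> consecutive\<^sup>*"
    using assms by (auto simp: trajectories_def quotient_def)
  then show ?thesis using sym_rtrancl_consecutive by (metis rtrancl_trans symD)
qed

lemma trajectories_prime_interval:
  assumes "T \<in> trajectories" "p \<in> T"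
  shows "p \<in> PrInt UNIV"
proof -
  obtain r where "(r, p) \<in> consecutive\<^sup>*" "r \<in> PrInt UNIV"
    using assms by (auto simp: trajectories_def quotient_def)
  then show ?thesis by (induction rule: rtrancl_induct) (auto simp: consecutive_def)
qed

section \<open>Equivalence of the two trajectory conditions\<close>

text \<open>The second half of (iii), phrased by pairs in the closure instead of members of a
  class.\<close>

definition trajectories_incomparable :: "'a::lattice itself \<Rightarrow> bool" where
  "trajectories_incomparable TYPE('a) \<longleftrightarrow>
     (\<forall>p q :: 'a \<times> 'a. p \<in> PrInt UNIV \<longrightarrow> (p, q) \<in> consecutive\<^sup>* \<longrightarrow> \<not> comparable p q)"

lemma trajectories_incomparable_iff:
  "trajectories_incomparable TYPE('a::lattice) \<longleftrightarrow>
     \<not> (\<exists>T \<in> trajectories. \<exists>p \<in> T. \<exists>q \<in> T. p \<noteq> q \<and> comparable p (q :: 'a \<times> 'a))"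
proof
  assume "trajectories_incomparable TYPE('a)"
  then show "\<not> (\<exists>T \<in> trajectories. \<exists>p \<in> T. \<exists>q \<in> T. p \<noteq> q \<and> comparable p (q :: 'a \<times> 'a))"
    unfolding trajectories_incomparable_def
    by (meson trajectories_sameD trajectories_prime_interval)
next
  assume h: "\<not> (\<exists>T \<in> trajectories. \<exists>p \<in> T. \<exists>q \<in> T. p \<noteq> q \<and> comparable p (q :: 'a \<times> 'a))"
  show "trajectories_incomparable TYPE('a)"
    unfolding trajectories_incomparable_def
  proof (intro allI impI notI)
    fix p q :: "'a \<times> 'a"
    assume "p \<in> PrInt UNIV" "(p, q) \<in> consecutive\<^sup>*" "comparable p q"
    moreover from this have "consecutive\<^sup>* `` {p} \<in> trajectories"
      by (auto simp: trajectories_def intro: quotientI)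
    moreover have "p \<noteq> q" using \<open>comparable p q\<close> by (auto simp: comparable_def)
    ultimately show False using h by blast
  qed
qed

lemma trajectories_incomparableD:
  assumes "trajectories_incomparable TYPE('a::lattice)"
    and "((a, b), (c, d)) \<in> consecutive\<^sup>*" "covered a b" "b \<le> c"
  shows "(a :: 'a) = c \<and> b = d"
proof -
  have "\<not> comparable (a, b) (c, d)"
    using assms unfolding trajectories_incomparable_def PrInt_def by blast
  then show ?thesis using assms(4) by (simp add: comparable_def)
qed

text \<open>If the lower ends differ, the larger one is not strictly inside the other interval, so
  one interval lies above the other; equal lower ends force equal upper ends.\<close>

lemma PrInt_chain_comparable:
  assumes "pred_on.chain UNIV (<) C" "p \<in> PrInt C" "q \<in> PrInt C" "p \<noteq> q"
  shows "comparable p q"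
proof -
  obtain a b c d where pq: "p = (a, b)" "q = (c, d)" by (cases p; cases q)
  have mem: "a \<in> C" "b \<in> C" "c \<in> C" "d \<in> C" and lt: "a < b" "c < d"
    and nb: "\<And>z. z \<in> C \<Longrightarrow> a < z \<Longrightarrow> \<not> z < b" "\<And>z. z \<in> C \<Longrightarrow> c < z \<Longrightarrow> \<not> z < d"
    using assms(2,3) by (auto simp: pq PrInt_def covered_in_def)
  have lin: "x \<le> y \<or> y \<le> x" if "x \<in> C" "y \<in> C" for x y
    using assms(1) that by (auto simp: chain_iff)
  have "b \<le> c" if "a < c" using nb(1)[of c] lin[of b c] mem that by (auto simp: order.order_iff_strict)
  moreover have "d \<le> a" if "c < a"
    using nb(2)[of a] lin[of d a] mem that by (auto simp: order.order_iff_strict)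
  moreover have "b = d" if "a = c"
    using nb(1)[of d] nb(2)[of b] lin[of b d] mem lt that by (auto simp: order.order_iff_strict)
  ultimately show ?thesis
    using lin[of a c] mem assms(4) by (auto simp: comparable_def pq order.order_iff_strict)
qed

text \<open>A maximal chain always meets the trajectory, and distinct prime intervals of a chain are
  comparable, so incomparability gives uniqueness. Conversely, two comparable intervals of one
  trajectory would lie in a common maximal chain.\<close>

lemma trajectory_maximal_chain_card_iff:
  assumes fl: "finite_length TYPE('a::lattice)" and sm: "semimodular TYPE('a)"
  shows "(\<forall>T \<in> trajectories. \<forall>C :: 'a set. maximal_chain C \<longrightarrow> card (PrInt C \<inter> T) = 1)
    \<longleftrightarrow> trajectories_incomparable TYPE('a)"
proof
  assume one: "\<forall>T \<in> trajectories. \<forall>C :: 'a set. maximal_chain C \<longrightarrow> card (PrInt C \<inter> T) = 1"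
  have no: False if T: "T \<in> trajectories" and "(a, b) \<in> T" "(c, d) \<in> T" "(a, b) \<noteq> (c, d)" "b \<le> c"
    for a b c d :: 'a and T :: "('a \<times> 'a) set"
  proof -
    have cov: "covered a b" "covered c d"
      using trajectories_prime_interval[OF T] that by (auto simp: PrInt_def)
    then have "a \<le> b" "c \<le> d" by (auto dest: coveredD)
    then have "pred_on.chain UNIV (<) {a, b, c, d}"
      using \<open>b \<le> c\<close> by (auto simp: chain_iff)
    then obtain C where C: "maximal_chain C" "{a, b, c, d} \<subseteq> C"
      using chain_extends_maximal[OF fl] by blast
    have "(a, b) \<in> PrInt C" "(c, d) \<in> PrInt C"
      using cov C(2) by (auto simp: PrInt_def covered_in_def)
    then have "{(a, b), (c, d)} \<subseteq> PrInt C \<inter> T" using that by simp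
    moreover have "card (PrInt C \<inter> T) = 1" using one T C by blast
    then obtain r where "PrInt C \<inter> T = {r}" by (auto simp: card_1_singleton_iff)
    ultimately show False using that by auto
  qed
  show "trajectories_incomparable TYPE('a)"
    unfolding trajectories_incomparable_iff
  proof (intro notI, elim bexE conjE)
    fix T :: "('a \<times> 'a) set" and p q
    assume T: "T \<in> trajectories" "p \<in> T" "q \<in> T" and "p \<noteq> q" "comparable p q"
    then consider "snd p \<le> fst q" | "snd q \<le> fst p" by (auto simp: comparable_def)
    then show False
    proof cases
      case 1
      then show False using no[OF T(1), of "fst p" "snd p" "fst q" "snd q"] T \<open>p \<noteq> q\<close> by simp
    next
      case 2
      then show False using no[OF T(1), of "fst q" "snd q" "fst p" "snd p"] T \<open>p \<noteq> q\<close> by simp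
    qed
  qed
next
  assume inc: "trajectories_incomparable TYPE('a)"
  show "\<forall>T \<in> trajectories. \<forall>C :: 'a set. maximal_chain C \<longrightarrow> card (PrInt C \<inter> T) = 1"
  proof (intro ballI allI impI)
    fix T :: "('a \<times> 'a) set" and C :: "'a set"
    assume T: "T \<in> trajectories" and C: "maximal_chain C"
    obtain a b where ab: "covered a b" "T = consecutive\<^sup>* `` {(a, b)}"
      using T by (auto simp: trajectories_def quotient_def PrInt_def)
    obtain c d where cd: "(c, d) \<in> PrInt C" "((a, b), (c, d)) \<in> consecutive\<^sup>*"
      using maximal_chain_meets_trajectory[OF fl sm C ab(1)] by blast
    have "p = (c, d)" if "p \<in> PrInt C" "p \<in> T" for p
    proof (rule ccontr)
      assume "p \<noteq> (c, d)"
      then have "comparable p (c, d)"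
        using PrInt_chain_comparable[of C p "(c, d)"] C cd that unfolding pred_on.maxchain_def by blast
      then show False
        using inc trajectories_sameD[OF T that(2), of "(c, d)"] trajectories_prime_interval[OF T that(2)]
          cd(2) ab(2)
        unfolding trajectories_incomparable_def by blast
    qed
    moreover have "(c, d) \<in> PrInt C \<inter> T" using cd ab(2) by simp
    ultimately have "PrInt C \<inter> T = {(c, d)}" by blast
    then show "card (PrInt C \<inter> T) = 1" by simp
  qed
qed

section \<open>Independence of upper covers\<close>

text \<open>The content is the case of three distinct covers; for \<open>c = d\<close> this only
  says that upper covers form an antichain.\<close>

definition covers_independent :: "'a::lattice itself \<Rightarrow> bool" where
  "covers_independent TYPE('a) \<longleftrightarrow>
     (\<forall>a b c d :: 'a. covered a b \<longrightarrow> covered a c \<longrightarrow> covered a d \<longrightarrow> b \<le> sup c d \<longrightarrow> b = c \<or> b = d)"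

text \<open>Upward induction on \<open>a\<close>: for a cover \<open>d\<close> of \<open>a\<close>
  below \<open>n\<close>, replace \<open>a\<close>, \<open>b\<close>, \<open>c\<close> by
  \<open>d\<close>, \<open>sup b d\<close>, \<open>sup c d\<close>. Joining with \<open>n\<close>
  absorbs \<open>d\<close>.\<close>

lemma not_le_sup_cover:
  fixes a b c n :: "'a::lattice"
  assumes fl: "finite_length TYPE('a)" and sm: "semimodular TYPE('a)"
    and ind: "covers_independent TYPE('a)"
    and "covered a b" "covered a c" "b \<noteq> c" "a \<le> n" "\<not> b \<le> n"
  shows "\<not> b \<le> sup n c"
  using assms(4-)
proof (induction a arbitrary: b c rule: finite_length_greater_induct[OF fl])
  case (1 a)
  have lt: "a < b" "a < c" using 1 by (auto dest: coveredD)
  show ?case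
  proof (cases "a = n \<or> c \<le> n")
    case True
    then show ?thesis
    proof
      assume "a = n"
      then have "sup n c = c" using lt by (simp add: sup_absorb2)
      then show ?thesis using covered_antichain[OF 1(2,3)] 1(4) by auto
    next
      assume "c \<le> n"
      then show ?thesis using 1 by (simp add: sup_absorb1)
    qed
  next
    case False
    then obtain d where d: "covered a d" "d \<le> n"
      using finite_length_cover_below[OF fl, of a n] 1(5) by (metis order.order_iff_strict)
    have "a < d" using d by (auto dest: coveredD)
    have nd: "\<not> b \<le> d" "\<not> c \<le> d" using d False 1(6) by auto
    \<comment> \<open>The only use of independence: equality would put \<open>b\<close> below
      \<open>sup c d\<close>.\<close>
    have ne: "sup b d \<noteq> sup c d"
      using ind 1 d nd unfolding covers_independent_def by (metis order_refl sup.cobounded1)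
    have "\<not> sup b d \<le> sup n (sup c d)"
    proof (rule 1(1)[OF \<open>a < d\<close>])
      show "covered d (sup b d)" using semimodularD[OF sm 1(2) _ nd(1)] \<open>a < d\<close> by simp
      show "covered d (sup c d)" using semimodularD[OF sm 1(3) _ nd(2)] \<open>a < d\<close> by simp
    qed (use d 1 ne in auto)
    moreover have "sup n (sup c d) = sup n c"
      using d by (metis sup.absorb1 sup.assoc sup.commute)
    ultimately show ?thesis using d by (auto simp: le_supI1)
  qed
qed

text \<open>Climb from \<open>a\<close> to \<open>m\<close> one cover \<open>c\<close> at a time,
  replacing \<open>b\<close> by \<open>sup b c\<close> and \<open>n\<close> by
  \<open>sup n c\<close>; the previous lemma keeps \<open>b\<close> from falling below the new
  \<open>n\<close>.\<close>

lemma not_le_sup: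
  fixes a b m n :: "'a::lattice"
  assumes fl: "finite_length TYPE('a)" and sm: "semimodular TYPE('a)"
    and ind: "covers_independent TYPE('a)"
    and "covered a b" "a \<le> m" "a \<le> n" "\<not> b \<le> m" "\<not> b \<le> n"
  shows "\<not> b \<le> sup m n"
  using assms(4-)
proof (induction a arbitrary: b n rule: finite_length_greater_induct[OF fl])
  case (1 a)
  show ?case
  proof (cases "a = m")
    case True
    then show ?thesis using 1 by (simp add: sup_absorb2)
  next
    case False
    then obtain c where c: "covered a c" "c \<le> m"
      using finite_length_cover_below[OF fl, of a m] 1(3) by (metis order.order_iff_strict)
    have "a < c" using c by (auto dest: coveredD)
    have nc: "\<not> b \<le> c" "b \<noteq> c" using c 1 by auto
    have n: "\<not> b \<le> sup n c"
      using not_le_sup_cover[OF fl sm ind 1(2) c(1) nc(2)] 1 by blast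
    have "\<not> sup b c \<le> sup m (sup n c)"
    proof (rule 1(1)[OF \<open>a < c\<close>])
      show "covered c (sup b c)" using semimodularD[OF sm 1(2) _ nc(1)] \<open>a < c\<close> by simp
    qed (use c 1 n in auto)
    moreover have "sup m (sup n c) = sup m n"
      using c by (metis sup.absorb1 sup.assoc sup.commute)
    ultimately show ?thesis using c by (auto simp: le_supI1)
  qed
qed

section \<open>Labels of prime intervals\<close>

text \<open>Such an \<open>m\<close> is meet-irreducible: every element strictly above it lies above
  \<open>snd p\<close>.\<close>

definition is_label :: "'a::lattice \<times> 'a \<Rightarrow> 'a \<Rightarrow> bool" where
  "is_label p m \<longleftrightarrow> fst p \<le> m \<and> \<not> snd p \<le> m \<and> (\<forall>n. fst p \<le> n \<longrightarrow> \<not> snd p \<le> n \<longrightarrow> n \<le> m)"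

text \<open>The candidates are closed under joins by \<open>not_le_sup\<close>, so a maximal one is
  greatest.\<close>

lemma ex_label:
  fixes a b :: "'a::lattice"
  assumes fl: "finite_length TYPE('a)" and sm: "semimodular TYPE('a)"
    and ind: "covers_independent TYPE('a)" and ab: "covered a b"
  shows "\<exists>m. is_label (a, b) m"
proof -
  let ?W = "{m. a \<le> m \<and> \<not> b \<le> m}"
  have "a \<in> ?W" using coveredD[OF ab] by auto
  from finite_length_maximal[OF fl this]
  obtain m where m: "m \<in> ?W" "\<forall>y\<in>?W. \<not> m < y" ..
  have "n \<le> m" if "n \<in> ?W" for n
  proof -
    have "\<not> b \<le> sup m n" by (rule not_le_sup[OF fl sm ind ab]) (use m that in simp_all)
    moreover have "a \<le> sup m n" using m(1) by (simp add: le_supI1)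
    ultimately have "sup m n \<in> ?W" by simp
    then have "sup m n = m" using m(2) by (metis order.order_iff_strict sup.cobounded1)
    then show ?thesis by (metis sup.cobounded2)
  qed
  then show ?thesis using m by (auto simp: is_label_def)
qed

lemma is_label_consecutive:
  fixes p q :: "'a::lattice \<times> 'a"
  assumes fl: "finite_length TYPE('a)" and sm: "semimodular TYPE('a)"
    and ind: "covers_independent TYPE('a)"
    and "(p, q) \<in> consecutive" "is_label p m"
  shows "is_label q m"
  using assms(4)
proof (cases rule: consecutive_cases)
  case (up u x y v)
  then have m: "u \<le> m" "\<not> x \<le> m" "\<And>n. u \<le> n \<Longrightarrow> \<not> x \<le> n \<Longrightarrow> n \<le> m"
    using assms(5) by (auto simp: is_label_def)
  have "n \<le> m" if "y \<le> n" "\<not> v \<le> n" for n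
    using m(3)[of n] that up by auto
  then show ?thesis using m up by (auto simp: is_label_def)
next
  case (down u x y v)
  then have m: "y \<le> m" "\<not> v \<le> m" "\<And>n. y \<le> n \<Longrightarrow> \<not> v \<le> n \<Longrightarrow> n \<le> m"
    using assms(5) by (auto simp: is_label_def)
  have "n \<le> m" if "u \<le> n" "\<not> x \<le> n" for n
  proof -
    \<comment> \<open>Going down enlarges the set of candidates, but \<open>sup n y\<close> is again
      a candidate for the upper interval.\<close>
    have "\<not> x \<le> sup n y" using not_le_sup[OF fl sm ind] down that by blast
    then have "sup n y \<le> m" using m(3)[of "sup n y"] down by auto
    then show ?thesis by simp
  qed
  moreover have "u \<le> m" using down m(1) by (meson order_trans)
  ultimately show ?thesis using m down by (auto simp: is_label_def)
qed

lemma covers_independent_imp_incomparable: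
  assumes fl: "finite_length TYPE('a::lattice)" and sm: "semimodular TYPE('a)"
    and ind: "covers_independent TYPE('a)"
  shows "trajectories_incomparable TYPE('a)"
  unfolding trajectories_incomparable_def
proof (intro allI impI notI)
  fix p q :: "'a \<times> 'a"
  assume p: "p \<in> PrInt UNIV" and pq: "(p, q) \<in> consecutive\<^sup>*" and cmp: "comparable p q"
  obtain m where m: "is_label p m"
    using ex_label[OF fl sm ind] p by (cases p) (auto simp: PrInt_def)
  from pq have "is_label q m"
    by (induction rule: rtrancl_induct) (auto intro: m is_label_consecutive[OF fl sm ind])
  \<comment> \<open>A common label would lie above the lower end of the higher interval, hence above
    the upper end of the lower one.\<close>
  with m cmp show False
    unfolding comparable_def is_label_def by (meson order_trans)
qed

text \<open>If \<open>b\<close> and \<open>c\<close> are distinct, they meet in \<open>a\<close>,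
  and distributivity in the interval turns \<open>inf (sup d b) (sup d c)\<close> into
  \<open>d\<close>; but \<open>b\<close> lies below that meet.\<close>

lemma join_distributive_imp_covers_independent:
  assumes "join_distributive TYPE('a::lattice)"
  shows "covers_independent TYPE('a)"
  unfolding covers_independent_def
proof (intro allI impI)
  fix a b c d :: 'a
  assume cov: "covered a b" "covered a c" "covered a d" and b: "b \<le> sup c d"
  have fin: "finite {y. covered a y}"
    using assms unfolding join_distributive_def by (meson rev_finite_subset subset_UNIV)
  let ?s = "join_upper_covers a"
  have lt: "a < b" "a < c" "a < d" using cov by (auto dest: coveredD)
  then have "\<not> (\<forall>y. y \<le> a)" by (auto simp: less_le_not_le)
  then have "distributive_sublattice {a..?s}"
    using assms by (simp add: join_distributive_def)
  moreover have "x \<in> {a..?s}" if "covered a x" for x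
    using Sup_fin.coboundedI[OF fin] coveredD[OF that] that
    by (simp add: join_upper_covers_def)
  ultimately have dist: "sup d (inf b c) = inf (sup d b) (sup d c)"
    using cov unfolding distributive_sublattice_def by blast
  show "b = c \<or> b = d"
  proof (cases "b \<le> c")
    case True
    then show ?thesis using covered_antichain[OF cov(1,2)] by simp
  next
    case False
    then have "inf b c = a" using covered_inf_eq[OF cov(1)] lt by simp
    then have "inf (sup d b) (sup d c) = d" using dist lt by (simp add: sup_absorb1)
    then have "b \<le> d" using b by (metis le_inf_iff sup.cobounded2 sup.commute)
    then show ?thesis using covered_antichain[OF cov(1,3)] by simp
  qed
qed

section \<open>From trajectories to join-distributivity\<close>

text \<open>In the diamond with top \<open>?v\<close>, the steps \<open>[a, b]\<close>,
  \<open>[d, ?v]\<close>, \<open>[a, c]\<close>, \<open>[b, ?v]\<close> link two comparable prime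
  intervals.\<close>

lemma incomparable_imp_covers_independent:
  assumes sm: "semimodular TYPE('a::lattice)" and inc: "trajectories_incomparable TYPE('a)"
  shows "covers_independent TYPE('a)"
  unfolding covers_independent_def
proof (intro allI impI, rule ccontr)
  fix a b c d :: 'a
  assume cov: "covered a b" "covered a c" "covered a d" and b: "b \<le> sup c d"
    and ne: "\<not> (b = c \<or> b = d)"
  have lt: "a < b" "a < c" "a < d" using cov by (auto dest: coveredD)
  have cd: "c \<noteq> d"
    using b ne covered_antichain[OF cov(1,2)] by auto
  have nle: "\<not> c \<le> b" "\<not> d \<le> b" "\<not> b \<le> c" "\<not> b \<le> d" "\<not> c \<le> d" "\<not> d \<le> c"
    using cov ne cd by (blast dest: covered_antichain)+
  let ?v = "sup c d"
  have "covered c ?v" using semimodularD[OF sm cov(3), of c] lt nle by (simp add: sup_commute)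
  then have bc: "sup b c = ?v"
    using covered_between[of c ?v "sup b c"] b nle(3) by (metis sup.cobounded1 sup.cobounded2 le_sup_iff)
  have "covered d ?v" using semimodularD[OF sm cov(2), of d] lt nle by simp
  then have bd: "sup b d = ?v"
    using covered_between[of d ?v "sup b d"] b nle(4) by (metis sup.cobounded1 sup.cobounded2 le_sup_iff)
  have "((a, b), (d, ?v)) \<in> consecutive"
    using consecutiveI[OF sm cov(1,3)] ne bd by simp
  moreover have "((d, ?v), (a, c)) \<in> consecutive"
    using consecutive_sym[OF consecutiveI[OF sm cov(2,3) cd]] .
  moreover have "((a, c), (b, ?v)) \<in> consecutive"
    using consecutiveI[OF sm cov(2,1)] ne bc by (auto simp: sup_commute)
  ultimately have "((a, b), (b, ?v)) \<in> consecutive\<^sup>*" by auto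
  from trajectories_incomparableD[OF inc this cov(1)] show False using lt by simp
qed

text \<open>Each \<open>[a, b]\<close> is sent to a prime interval of one fixed maximal chain in its
  trajectory. The map is injective: if \<open>[a, b]\<close> and \<open>[a, c]\<close> shared a
  trajectory, so would \<open>[a, c]\<close> and \<open>[c, sup b c]\<close>.\<close>

lemma incomparable_imp_finite_upper_covers:
  fixes a :: "'a::lattice"
  assumes fl: "finite_length TYPE('a)" and sm: "semimodular TYPE('a)"
    and inc: "trajectories_incomparable TYPE('a)"
  shows "finite {b. covered a b}"
proof -
  have "pred_on.chain UNIV (<) ({} :: 'a set)" by (simp add: chain_iff)
  then obtain C :: "'a set" where C: "maximal_chain C"
    using chain_extends_maximal[OF fl] by blast
  then have "finite C" using finite_length_chain[OF fl] unfolding pred_on.maxchain_def by blast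
  have "PrInt C \<subseteq> C \<times> C" by (auto simp: PrInt_def covered_in_def)
  then have fin: "finite (PrInt C)" by (rule finite_subset) (simp add: \<open>finite C\<close>)
  have "\<exists>r. r \<in> PrInt C \<and> ((a, b), r) \<in> consecutive\<^sup>*" if "covered a b" for b
    using maximal_chain_meets_trajectory[OF fl sm C that] by blast
  then obtain f where f: "\<And>b. covered a b \<Longrightarrow> f b \<in> PrInt C"
    "\<And>b. covered a b \<Longrightarrow> ((a, b), f b) \<in> consecutive\<^sup>*" by metis
  have "inj_on f {b. covered a b}"
  proof (rule inj_onI, rule ccontr)
    fix b c assume bc: "b \<in> {b. covered a b}" "c \<in> {b. covered a b}" "f b = f c" "b \<noteq> c"
    then have "((a, c), (a, b)) \<in> consecutive\<^sup>*"
      using f(2)[of b] f(2)[of c] sym_rtrancl_consecutive by (metis mem_Collect_eq rtrancl_trans symD)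
    moreover have "((a, b), (c, sup b c)) \<in> consecutive"
      using consecutiveI[OF sm] bc by blast
    ultimately have "((a, c), (c, sup b c)) \<in> consecutive\<^sup>*" by auto
    from trajectories_incomparableD[OF inc this] show False using bc coveredD[of a c] by auto
  qed
  moreover have "f ` {b. covered a b} \<subseteq> PrInt C" using f by auto
  ultimately show ?thesis using fin by (meson finite_imageD finite_subset)
qed

text \<open>Apart from \<open>a\<close> itself, the up-set of \<open>a\<close> is the union of the
  up-sets of its finitely many covers; the up-set of the least element is everything.\<close>

lemma finite_of_finite_upper_covers:
  assumes fl: "finite_length TYPE('a::lattice)"
    and fin: "\<And>a :: 'a. finite {b. covered a b}"
  shows "finite (UNIV :: 'a set)"
proof -
  have "finite {a..}" for a :: 'a
  proof (induction a rule: finite_length_greater_induct[OF fl])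
    case (1 a)
    have "{a..} \<subseteq> insert a (\<Union>b\<in>{b. covered a b}. {b..})"
    proof
      fix y assume "y \<in> {a..}"
      then show "y \<in> insert a (\<Union>b\<in>{b. covered a b}. {b..})"
        using finite_length_cover_below[OF fl, of a y] by (auto simp: order.order_iff_strict)
    qed
    moreover have "finite (insert a (\<Union>b\<in>{b. covered a b}. {b..}))"
      using fin 1 by (auto dest: coveredD)
    ultimately show ?case by (rule finite_subset)
  qed
  moreover obtain z :: 'a where "\<And>x. z \<le> x" using finite_length_bot[OF fl] by blast
  then have "{z..} = UNIV" by auto
  ultimately show ?thesis by metis
qed

section \<open>Distributivity of the intervals\<close>

text \<open>This is what makes the embedding into a powerset reflect order. Otherwise some cover
  \<open>e\<close> of \<open>inf y z\<close> lies below \<open>y\<close>. It is below no join of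
  \<open>inf y z\<close> with a single cover of \<open>x\<close>, hence by \<open>not_le_sup\<close>
  not below the join with all of them.\<close>

lemma le_of_covers_le:
  fixes x y z :: "'a::lattice"
  assumes fl: "finite_length TYPE('a)" and sm: "semimodular TYPE('a)"
    and ind: "covers_independent TYPE('a)"
    and A: "finite {b. covered x b}" "{b. covered x b} \<noteq> {}"
    and xy: "x \<le> y" "y \<le> join_upper_covers x" and xz: "x \<le> z"
    and sub: "\<And>b. covered x b \<Longrightarrow> b \<le> y \<Longrightarrow> b \<le> z"
  shows "y \<le> z"
proof (rule ccontr)
  assume "\<not> y \<le> z"
  let ?t = "inf y z"
  have xt: "x \<le> ?t" using xy xz by simp
  have "?t < y" using \<open>\<not> y \<le> z\<close> by (metis inf.absorb_iff1 inf.cobounded1 order.order_iff_strict)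
  then obtain e where e: "covered ?t e" "e \<le> y" using finite_length_cover_below[OF fl] by blast
  have one: "\<not> e \<le> sup ?t b" if b: "covered x b" for b
  proof (cases "b \<le> ?t")
    case True
    then show ?thesis using coveredD[OF e(1)] by (simp add: sup_absorb1 less_le_not_le)
  next
    case False
    \<comment> \<open>If \<open>b\<close> were below \<open>y\<close>, it would be below
      \<open>z\<close> too and hence below \<open>?t\<close>. So \<open>sup b ?t\<close> and
      \<open>e\<close> are different covers of \<open>?t\<close>.\<close>
    then have "\<not> b \<le> y" using sub[OF b] by auto
    then have "\<not> b \<le> e" using e by (meson order_trans)
    have "covered ?t (sup b ?t)" by (rule semimodularD[OF sm b xt False])
    then show ?thesis
      using covered_between[of ?t "sup b ?t" e] coveredD[OF e(1)] \<open>\<not> b \<le> e\<close>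
      by (metis less_le_not_le order_refl sup.cobounded1 sup_commute)
  qed
  have "\<not> e \<le> sup ?t (Sup_fin B)" if "finite B" "B \<noteq> {}" "B \<subseteq> {b. covered x b}" for B
    using that
  proof (induction rule: finite_ne_induct)
    case (singleton b)
    then show ?case using one by simp
  next
    case (insert b B)
    have "\<not> e \<le> sup (sup ?t b) (sup ?t (Sup_fin B))"
      by (rule not_le_sup[OF fl sm ind e(1)]) (use insert one in auto)
    then show ?case using insert by (simp add: ac_simps)
  qed
  from this[OF A] have "\<not> e \<le> sup ?t (join_upper_covers x)"
    by (simp add: join_upper_covers_def)
  moreover have "e \<le> join_upper_covers x" using e xy by (meson order_trans)
  ultimately show False by (simp add: le_supI2)
qed

lemma incomparable_imp_join_distributive:
  assumes fl: "finite_length TYPE('a::lattice)" and sm: "semimodular TYPE('a)"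
    and inc: "trajectories_incomparable TYPE('a)"
  shows "join_distributive TYPE('a)"
  unfolding join_distributive_def
proof (intro conjI allI impI)
  note ind = incomparable_imp_covers_independent[OF sm inc]
  have fin: "finite {b. covered a b}" for a :: 'a
    using incomparable_imp_finite_upper_covers[OF fl sm inc] .
  show "finite (UNIV :: 'a set)" using finite_of_finite_upper_covers[OF fl fin] .
  fix x :: 'a
  assume "\<not> (\<forall>y. y \<le> x)"
  then obtain y where "\<not> y \<le> x" by blast
  then have "x < sup x y" by (metis order.order_iff_strict sup.cobounded1 sup.cobounded2)
  then obtain b where b: "covered x b" using finite_length_cover_below[OF fl] by blast
  then have ne: "{b. covered x b} \<noteq> {}" by blast
  let ?s = "join_upper_covers x"
  have "b \<le> ?s" using Sup_fin.coboundedI[OF fin] b by (simp add: join_upper_covers_def)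
  then have "x \<le> ?s" using coveredD[OF b] by simp
  \<comment> \<open>Upper covers of \<open>x\<close> behave as join-primes above \<open>x\<close>,
    so joins correspond to unions of sets of covers, and meets to intersections.\<close>
  have join: "b \<le> sup y z \<longleftrightarrow> b \<le> y \<or> b \<le> z" if "covered x b" "x \<le> y" "x \<le> z" for b y z
    using not_le_sup[OF fl sm ind that] by (auto intro: le_supI1 le_supI2)
  show "distributive_sublattice {x..?s}"
    unfolding distributive_sublattice_def
  proof (intro conjI ballI)
    show "sublattice {x..?s}"
      using \<open>x \<le> ?s\<close> by (auto simp: sublattice_def intro: le_infI1 le_supI1)
    fix u v w assume uvw: "u \<in> {x..?s}" "v \<in> {x..?s}" "w \<in> {x..?s}"
    show "sup u (inf v w) = inf (sup u v) (sup u w)"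
    proof (rule antisym)
      show "sup u (inf v w) \<le> inf (sup u v) (sup u w)" by (rule distrib_sup_le)
      show "inf (sup u v) (sup u w) \<le> sup u (inf v w)"
      proof (rule le_of_covers_le[OF fl sm ind fin ne])
        show "x \<le> inf (sup u v) (sup u w)" "inf (sup u v) (sup u w) \<le> ?s"
          using uvw by (auto intro: le_supI1 le_infI1)
        show "x \<le> sup u (inf v w)" using uvw by (auto intro: le_supI1)
        fix b assume b: "covered x b" "b \<le> inf (sup u v) (sup u w)"
        then show "b \<le> sup u (inf v w)" using uvw by (auto simp: join)
      qed
    qed
  qed
qed

theorem corollary6:
  assumes "semimodular TYPE('a::lattice)"
  shows
    "(join_distributive TYPE('a) \<longleftrightarrow>
        finite_length TYPE('a) \<and>
        (\<forall>T \<in> trajectories. \<forall>C :: 'a set. maximal_chain C \<longrightarrow> card (PrInt C \<inter> T) = 1)) \<and>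
     (join_distributive TYPE('a) \<longleftrightarrow>
        finite_length TYPE('a) \<and>
        \<not> (\<exists>T \<in> trajectories. \<exists>p \<in> T. \<exists>q \<in> T.
             p \<noteq> q \<and> comparable p (q :: 'a \<times> 'a)))"
proof -
  \<comment> \<open>In (i) finite length comes from finiteness.\<close>
  have "finite_length TYPE('a)" if "join_distributive TYPE('a)"
    using that finite_length_of_finite by (auto simp: join_distributive_def)
  then have "join_distributive TYPE('a) \<longleftrightarrow>
      finite_length TYPE('a) \<and> trajectories_incomparable TYPE('a)"
    using covers_independent_imp_incomparable join_distributive_imp_covers_independent
      incomparable_imp_join_distributive assms by blast
  then show ?thesis
    using trajectory_maximal_chain_card_iff[OF _ assms]
    unfolding trajectories_incomparable_iff by blast
qed

end
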